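(* Let $X\subset\mathbb{R}$ be a Borel set, $\mu$ a Borel probability measure on $X$, and $\tau:X\to X$ a measurable map, such that $\mu$ and $\mu\circ\tau^{-1}$ have finite moments of all orders and $\tau^j\in\mathcal{P}$ for all $j\in\mathbb{N}_0$, where $\mathcal{P}$ is the closed linear span of the monomials in $L^2(\mu)$. Let $\{v_j\}_{j\in\mathbb{N}_0}$ be the reduced list of monomials, $\{p_k\}_{k\in\mathbb{N}_0}$ the associated orthonormal polynomials, and $R$ the operator in $\mathcal{P}$ with $Rp_k=v_k$. Let $N^{(\mu)}$ be the adjusted moment matrix of $\mu$ and $N^{(\mu\circ\tau^{-1})}$ the corresponding moment matrix of $\mu\circ\tau^{-1}$. Let $A=(A_{j,k})$ be an infinite matrix satisfying $$v_k\circ\tau=\sum_{j=0}^\infty A_{j,k}v_j\quad (k\in\mathbb{N}_0),\text{ with convergence in } L^2(\mu),$$ and suppose that $A$ is the matrix, with respect to the orthonormal basis $\{p_k\}_{k\in\mathbb{N}_0}$, of an operator (also denoted $A$) in $\mathcal{P}$ whose domain contains the monomials, and that the operator composition $RA$ is densely defined. Then $$A^*N^{(\mu)}A=N^{(\mu\circ\tau^{-1})}.$$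
   Context: Inner products are linear in the second variable. The reduced list $\{v_j\}$ is obtained from the monomial functions $1,x,x^2,\dots$ in $L^2(\mu)$ by removing every $x^j$ that is linearly dependent in $L^2(\mu)$ on $1,x,\dots,x^{j-1}$; thus each $v_j$ is a monomial and the $v_j$ have no finite linear dependence relations. $\{p_k\}$ is the result of the Gram–Schmidt process applied to $\{v_j\}$ in $L^2(\mu)$; it is an orthonormal basis of $\mathcal{P}$ and $p_0\equiv1$. The operator $R$ is given by $Rf=\sum_k\langle p_k|f\rangle_{L^2(\mu)}v_k$ on those $f\in\mathcal P$ for which the series converges in $L^2(\mu)$; $RA$ has domain $\{f\in\mathrm{dom}(A):Af\in\mathrm{dom}(R)\}$. The adjusted moment matrices are $$N^{(\mu)}_{j,k}=\langle v_j|v_k\rangle_{L^2(\mu)},\qquad N^{(\mu\circ\tau^{-1})}_{j,k}=\langle v_j\circ\tau|v_k\circ\tau\rangle_{L^2(\mu)}=\int v_jv_k\,\mathrm{d}(\mu\circ\tau^{-1}).$$ $A^*$ is the conjugate transpose of $A$, and the matrix product is taken by the usual entrywise (iterated) summation rule. *)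

theory Defs
  imports "HOL-Probability.Probability"
begin

text \<open>
  Elements of \<open>L\<^sup>2(M)\<close> are represented by square-integrable functions \<open>real \<Rightarrow> complex\<close>;
  identities in \<open>L\<^sup>2(M)\<close> are almost-everywhere identities or are expressed by the \<open>L\<^sup>2\<close> seminorm.
\<close>

definition L2 :: "real measure \<Rightarrow> (real \<Rightarrow> complex) set" where
  "L2 M = {f \<in> borel_measurable M. integrable M (\<lambda>x. (cmod (f x))\<^sup>2)}"

definition ip :: "real measure \<Rightarrow> (real \<Rightarrow> complex) \<Rightarrow> (real \<Rightarrow> complex) \<Rightarrow> complex" where
  "ip M f g = (\<integral>x. cnj (f x) * g x \<partial>M)"

definition L2_norm :: "real measure \<Rightarrow> (real \<Rightarrow> complex) \<Rightarrow> real" where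
  "L2_norm M f = sqrt (\<integral>x. (cmod (f x))\<^sup>2 \<partial>M)"

definition L2_closure :: "real measure \<Rightarrow> (real \<Rightarrow> complex) set \<Rightarrow> (real \<Rightarrow> complex) set" where
  "L2_closure M S = {f \<in> L2 M. \<forall>e>0. \<exists>g\<in>S \<inter> L2 M. L2_norm M (\<lambda>x. f x - g x) < e}"

text \<open>
  Series are indexed by a set \<open>I\<close> of natural numbers and summed in increasing order of the index;
  convergence may be conditional. For \<open>I = UNIV\<close> these are the usual series.
\<close>

definition L2_sums ::
  "real measure \<Rightarrow> nat set \<Rightarrow> (nat \<Rightarrow> real \<Rightarrow> complex) \<Rightarrow> (real \<Rightarrow> complex) \<Rightarrow> bool" where
  "L2_sums M I F g \<longleftrightarrow> (\<forall>j\<in>I. F j \<in> L2 M) \<and> g \<in> L2 M \<and>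
     (\<lambda>n. L2_norm M (\<lambda>x. (\<Sum>j | j \<in> I \<and> j < n. F j x) - g x)) \<longlonglongrightarrow> 0"

definition lin_span :: "(real \<Rightarrow> complex) set \<Rightarrow> (real \<Rightarrow> complex) set" where
  "lin_span S = {(\<lambda>x. \<Sum>f\<in>F. c f * f x) | F c. finite F \<and> F \<subseteq> S}"

definition monomial :: "nat \<Rightarrow> real \<Rightarrow> complex" where
  "monomial n x = complex_of_real x ^ n"

definition poly_space :: "real measure \<Rightarrow> (real \<Rightarrow> complex) set" where
  "poly_space M = L2_closure M (lin_span (range monomial))"

definition reduced_exponents :: "real measure \<Rightarrow> nat set" where
  "reduced_exponents M =
     {j. \<not> (\<exists>c :: nat \<Rightarrow> complex. AE x in M. monomial j x = (\<Sum>i<j. c i * monomial i x))}"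

text \<open>
  The reduced list is infinite, with index set \<open>UNIV\<close>, unless \<open>M\<close> is carried by a finite
  set. In that exceptional case the list is finite, the index set is a proper initial segment of the
  natural numbers, and values of the functions below at other indices are irrelevant.
\<close>

definition idx :: "real measure \<Rightarrow> nat set" where
  "idx M = {k. infinite (reduced_exponents M) \<or> k < card (reduced_exponents M)}"

definition reduced_monomial :: "real measure \<Rightarrow> nat \<Rightarrow> real \<Rightarrow> complex" where
  "reduced_monomial M k = monomial (enumerate (reduced_exponents M) k)"

fun orth_poly :: "real measure \<Rightarrow> nat \<Rightarrow> real \<Rightarrow> complex" where
  "orth_poly M k =
     (let u = (\<lambda>x. reduced_monomial M k x
                 - (\<Sum>i<k. ip M (orth_poly M i) (reduced_monomial M k) * orth_poly M i x))
      in (\<lambda>x. u x / complex_of_real (L2_norm M u)))"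

declare orth_poly.simps [simp del]

text \<open>
  An operator is a domain together with a map on representatives. The map matters only on the
  domain, and only up to almost-everywhere equality.
\<close>

type_synonym l2_operator = "(real \<Rightarrow> complex) set \<times> ((real \<Rightarrow> complex) \<Rightarrow> (real \<Rightarrow> complex))"

abbreviation op_dom :: "l2_operator \<Rightarrow> (real \<Rightarrow> complex) set" where
  "op_dom T \<equiv> fst T"

abbreviation op_app :: "l2_operator \<Rightarrow> (real \<Rightarrow> complex) \<Rightarrow> (real \<Rightarrow> complex)" where
  "op_app T \<equiv> snd T"

definition operator_in :: "real measure \<Rightarrow> (real \<Rightarrow> complex) set \<Rightarrow> l2_operator \<Rightarrow> bool" where
  "operator_in M H T \<longleftrightarrow>
     op_dom T \<subseteq> H \<and>
     (\<lambda>x. 0) \<in> op_dom T \<and>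
     (\<forall>a b. \<forall>f\<in>op_dom T. \<forall>g\<in>op_dom T. (\<lambda>x. a * f x + b * g x) \<in> op_dom T) \<and>
     (\<forall>f\<in>op_dom T. \<forall>g\<in>L2 M. (AE x in M. f x = g x) \<longrightarrow> g \<in> op_dom T) \<and>
     (\<forall>f\<in>op_dom T. op_app T f \<in> H) \<and>
     (\<forall>f\<in>op_dom T. \<forall>g\<in>op_dom T. (AE x in M. f x = g x) \<longrightarrow>
        (AE x in M. op_app T f x = op_app T g x)) \<and>
     (\<forall>a b. \<forall>f\<in>op_dom T. \<forall>g\<in>op_dom T.
        AE x in M. op_app T (\<lambda>x. a * f x + b * g x) x = a * op_app T f x + b * op_app T g x)"

definition op_comp :: "l2_operator \<Rightarrow> l2_operator \<Rightarrow> l2_operator" where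
  "op_comp S T = ({f \<in> op_dom T. op_app T f \<in> op_dom S}, \<lambda>f. op_app S (op_app T f))"

definition densely_defined :: "real measure \<Rightarrow> (real \<Rightarrow> complex) set \<Rightarrow> l2_operator \<Rightarrow> bool" where
  "densely_defined M H T \<longleftrightarrow> H \<subseteq> L2_closure M (op_dom T)"

definition R_op :: "real measure \<Rightarrow> l2_operator" where
  "R_op M =
     ({f \<in> poly_space M. \<exists>g.
         L2_sums M (idx M) (\<lambda>k x. ip M (orth_poly M k) f * reduced_monomial M k x) g},
      \<lambda>f. SOME g.
         L2_sums M (idx M) (\<lambda>k x. ip M (orth_poly M k) f * reduced_monomial M k x) g)"

text \<open>\<open>v\<close> need not be the reduced list of \<open>M\<close>.\<close>

definition moment_matrix :: "real measure \<Rightarrow> (nat \<Rightarrow> real \<Rightarrow> complex) \<Rightarrow> nat \<Rightarrow> nat \<Rightarrow> complex" where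
  "moment_matrix M v j k = ip M (v j) (v k)"

definition conj_transpose :: "(nat \<Rightarrow> nat \<Rightarrow> complex) \<Rightarrow> nat \<Rightarrow> nat \<Rightarrow> complex" where
  "conj_transpose A j k = cnj (A k j)"

text \<open>
  A relation rather than a function, so that it includes convergence of the series defining the
  entries of the product.
\<close>

definition has_mat_prod ::
  "nat set \<Rightarrow> (nat \<Rightarrow> nat \<Rightarrow> complex) \<Rightarrow> (nat \<Rightarrow> nat \<Rightarrow> complex) \<Rightarrow> (nat \<Rightarrow> nat \<Rightarrow> complex) \<Rightarrow> bool" where
  "has_mat_prod I A B C \<longleftrightarrow>
     (\<forall>j\<in>I. \<forall>k\<in>I. (\<lambda>l. if l \<in> I then A j l * B l k else 0) sums C j k)"

end

theory Submission imports Defs begin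

text \<open>
  Since the columns of \<open>A\<close> expand \<open>v\<^sub>k \<circ> \<tau>\<close> in \<open>L\<^sup>2(\<mu>)\<close>, continuity of the inner product gives
  \<open>(N A)\<^sub>j\<^sub>k = \<langle>v\<^sub>j | v\<^sub>k \<circ> \<tau>\<rangle>\<close> and \<open>(A\<^sup>* N)\<^sub>j\<^sub>k = \<langle>v\<^sub>j \<circ> \<tau> | v\<^sub>k\<rangle>\<close>, and a second application on the
  other side turns both products into \<open>\<langle>v\<^sub>j \<circ> \<tau> | v\<^sub>k \<circ> \<tau>\<rangle>\<close>.
\<close>

text \<open>The elementary bound |f g| <= |f|^2 + |g|^2 gives an integrable dominating function.
  There is no conjugate here, so the lemma serves both products of moduli and, through
  \<open>L2_cnj\<close>, inner products.\<close>

lemma L2_integrable_mult: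
  assumes f: "f \<in> L2 M" and g: "g \<in> L2 M"
  shows "integrable M (\<lambda>x. f x * g x)"
proof (rule Bochner_Integration.integrable_bound)
  show "integrable M (\<lambda>x. (cmod (f x))\<^sup>2 + (cmod (g x))\<^sup>2)"
    using f g by (simp add: L2_def)
  show "(\<lambda>x. f x * g x) \<in> borel_measurable M"
    using f g by (intro borel_measurable_times) (simp_all add: L2_def)
  have "a * b \<le> a\<^sup>2 + b\<^sup>2" if "0 \<le> a" "0 \<le> b" for a b :: real
    using sum_squares_bound[of a b] mult_nonneg_nonneg[OF that] by linarith
  then show "AE x in M. norm (f x * g x) \<le> norm ((cmod (f x))\<^sup>2 + (cmod (g x))\<^sup>2)"
    by (simp add: norm_mult)
qed

lemma borel_measurable_cnj:
  assumes "f \<in> borel_measurable M"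
  shows "(\<lambda>x. cnj (f x)) \<in> borel_measurable M"
proof (rule measurable_compose[OF assms])
  show "cnj \<in> borel_measurable borel"
    by (intro borel_measurable_continuous_onI continuous_on_cnj continuous_on_id)
qed

lemma L2_cnj: "f \<in> L2 M \<Longrightarrow> (\<lambda>x. cnj (f x)) \<in> L2 M"
  by (simp add: L2_def borel_measurable_cnj)

lemma L2_add:
  assumes f: "f \<in> L2 M" and g: "g \<in> L2 M"
  shows "(\<lambda>x. f x + g x) \<in> L2 M"
proof -
  have fm: "f \<in> borel_measurable M" and gm: "g \<in> borel_measurable M"
    using f g by (auto simp: L2_def)
  have "integrable M (\<lambda>x. (cmod (f x + g x))\<^sup>2)"
  proof (rule Bochner_Integration.integrable_bound)
    show "integrable M (\<lambda>x. 2 * ((cmod (f x))\<^sup>2 + (cmod (g x))\<^sup>2))"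
      using f g by (simp add: L2_def)
    show "(\<lambda>x. (cmod (f x + g x))\<^sup>2) \<in> borel_measurable M"
      using fm gm by measurable
    have "(cmod (a + b))\<^sup>2 \<le> 2 * ((cmod a)\<^sup>2 + (cmod b)\<^sup>2)" for a b
      using power_mono[OF norm_triangle_ineq[of a b], of 2] sum_squares_bound[of "cmod a" "cmod b"]
      by (simp add: power2_sum)
    then show "AE x in M. norm ((cmod (f x + g x))\<^sup>2) \<le> norm (2 * ((cmod (f x))\<^sup>2 + (cmod (g x))\<^sup>2))"
      by simp
  qed
  then show ?thesis
    using borel_measurable_add[OF fm gm] by (simp add: L2_def)
qed

lemma L2_uminus: "f \<in> L2 M \<Longrightarrow> (\<lambda>x. - f x) \<in> L2 M"
  by (auto simp: L2_def intro: borel_measurable_uminus)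

lemma L2_diff: "f \<in> L2 M \<Longrightarrow> g \<in> L2 M \<Longrightarrow> (\<lambda>x. f x - g x) \<in> L2 M"
  using L2_add[OF _ L2_uminus, of f M g] by simp

lemma L2_sum: "(\<And>i. i \<in> J \<Longrightarrow> F i \<in> L2 M) \<Longrightarrow> (\<lambda>x. \<Sum>i\<in>J. F i x) \<in> L2 M"
proof (induction J rule: infinite_finite_induct)
  case (insert i J)
  then show ?case
    by (simp add: L2_add)
\<comment> \<open>For an empty or infinite \<open>J\<close> the sum is the zero function, so
  finiteness of \<open>J\<close> is not assumed.\<close>
qed (simp_all add: L2_def)

lemma cnj_ip: "cnj (ip M f g) = ip M g f"
  unfolding ip_def Bochner_Integration.integral_cnj[symmetric] by (simp add: mult.commute)

text \<open>The inequality is taken for nonnegative extended integrals of the moduli. Integrability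
  of |f| |g| carries it over to real integrals, and the modulus of an integral is at most the
  integral of the modulus.\<close>

lemma ip_Cauchy_Schwarz:
  assumes f: "f \<in> L2 M" and g: "g \<in> L2 M"
  shows "cmod (ip M f g) \<le> L2_norm M f * L2_norm M g"
proof -
  have fm: "f \<in> borel_measurable M" "integrable M (\<lambda>x. (cmod (f x))\<^sup>2)"
    and gm: "g \<in> borel_measurable M" "integrable M (\<lambda>x. (cmod (g x))\<^sup>2)"
    using f g by (auto simp: L2_def)
  have fg: "integrable M (\<lambda>x. cmod (f x) * cmod (g x))"
    using integrable_norm[OF L2_integrable_mult[OF f g]] by (simp add: norm_mult)
  have "(\<integral>\<^sup>+x. ennreal (cmod (f x)) * ennreal (cmod (g x)) \<partial>M)\<^sup>2
      \<le> (\<integral>\<^sup>+x. (ennreal (cmod (f x)))\<^sup>2 \<partial>M) * (\<integral>\<^sup>+x. (ennreal (cmod (g x)))\<^sup>2 \<partial>M)"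
    using fm gm by (intro Cauchy_Schwarz_nn_integral) auto
  then have "(\<integral>x. cmod (f x) * cmod (g x) \<partial>M)\<^sup>2
      \<le> (\<integral>x. (cmod (f x))\<^sup>2 \<partial>M) * (\<integral>x. (cmod (g x))\<^sup>2 \<partial>M)"
    using fm gm fg
    by (simp add: nn_integral_eq_integral ennreal_power ennreal_mult'[symmetric])
  then have "(\<integral>x. cmod (f x) * cmod (g x) \<partial>M) \<le> L2_norm M f * L2_norm M g"
    unfolding L2_norm_def real_sqrt_mult[symmetric] by (rule real_le_rsqrt)
  moreover have "cmod (ip M f g) \<le> (\<integral>x. cmod (f x) * cmod (g x) \<partial>M)"
    unfolding ip_def using integral_norm_bound[of M "\<lambda>x. cnj (f x) * g x"]
    by (simp add: norm_mult)
  ultimately show ?thesis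
    by linarith
qed

text \<open>Continuity of the inner product: on partial sums it is finite linearity, and by
  Cauchy-Schwarz the error is at most the norm of \<open>h\<close> times the L2 distance from the
  partial sum to \<open>g\<close>. Conditional convergence suffices.\<close>

lemma L2_sums_ip_right:
  assumes F: "L2_sums M I F g" and h: "h \<in> L2 M"
  shows "(\<lambda>l. if l \<in> I then ip M h (F l) else 0) sums ip M h g"
proof -
  define S where "S n x = (\<Sum>j | j \<in> I \<and> j < n. F j x)" for n x
  have F2: "F j \<in> L2 M" if "j \<in> I" for j
    using F that by (simp add: L2_sums_def)
  have g: "g \<in> L2 M" and lim: "(\<lambda>n. L2_norm M (\<lambda>x. S n x - g x)) \<longlonglongrightarrow> 0"
    using F by (simp_all add: L2_sums_def S_def)
  have S2: "S n \<in> L2 M" for n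
    unfolding S_def using F2 by (intro L2_sum) auto
  \<comment> \<open>Padding with zeros off \<open>I\<close> makes the scalar partial sums agree, for
    each \<open>n\<close>, with those used by \<open>L2_sums\<close>.\<close>
  have partial: "(\<Sum>l<n. if l \<in> I then ip M h (F l) else 0) = ip M h (S n)" for n
  proof -
    have "(\<Sum>l<n. if l \<in> I then ip M h (F l) else 0) = (\<Sum>l | l \<in> I \<and> l < n. ip M h (F l))"
      by (rule sum.mono_neutral_cong_right) auto
    also have "\<dots> = ip M h (S n)"
      unfolding ip_def S_def sum_distrib_left
      using L2_integrable_mult[OF L2_cnj[OF h] F2] by (subst Bochner_Integration.integral_sum) auto
    finally show ?thesis .
  qed
  have "ip M h (S n) - ip M h g = ip M h (\<lambda>x. S n x - g x)" for n
    unfolding ip_def right_diff_distrib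
    by (rule Bochner_Integration.integral_diff[symmetric])
      (intro L2_integrable_mult L2_cnj h S2 g)+
  then have "cmod (ip M h (S n) - ip M h g) \<le> L2_norm M h * L2_norm M (\<lambda>x. S n x - g x)" for n
    using ip_Cauchy_Schwarz[OF h L2_diff[OF S2 g]] by simp
  moreover have "(\<lambda>n. L2_norm M h * L2_norm M (\<lambda>x. S n x - g x)) \<longlonglongrightarrow> 0"
    using tendsto_mult_left[OF lim, of "L2_norm M h"] by simp
  ultimately have "(\<lambda>n. ip M h (S n) - ip M h g) \<longlonglongrightarrow> 0"
    by (rule Lim_null_comparison[OF always_eventually[OF allI]])
  then have "(\<lambda>n. ip M h (S n)) \<longlonglongrightarrow> ip M h g"
    by (simp add: LIM_zero_iff)
  then show ?thesis
    by (simp add: sums_def partial)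
qed

text \<open>Conjugate the previous lemma: conjugation preserves convergence of series and swaps the
  two arguments of \<open>ip\<close>.\<close>

lemma L2_sums_ip_left:
  assumes F: "L2_sums M I F g" and h: "h \<in> L2 M"
  shows "(\<lambda>l. if l \<in> I then ip M (F l) h else 0) sums ip M g h"
proof -
  have "(\<lambda>l. cnj (if l \<in> I then ip M h (F l) else 0)) sums cnj (ip M h g)"
    using L2_sums_ip_right[OF F h] by (simp only: sums_cnj)
  then show ?thesis
    by (simp add: cnj_ip if_distrib cong: if_cong)
qed

text \<open>The squared modulus of the n-th monomial on the real line is x^(2n), so its integral is
  an even moment.\<close>

lemma monomial_in_L2:
  assumes meas: "(\<lambda>x. x) \<in> borel_measurable M" and moments: "\<And>n. integrable M (\<lambda>x. x ^ n)"
  shows "monomial n \<in> L2 M"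
proof -
  have "(cmod (monomial n x))\<^sup>2 = x ^ (2 * n)" for x
    by (simp add: monomial_def norm_power power_even_eq power_mult_distrib[symmetric] flip: power_abs)
  moreover have "monomial n \<in> borel_measurable M"
    unfolding monomial_def[abs_def]
    by (intro borel_measurable_power measurable_compose[OF meas]
        borel_measurable_continuous_onI continuous_intros)
  ultimately show ?thesis
    using moments by (simp add: L2_def)
qed

theorem theorem4p8:
  fixes X :: "real set" and \<mu> :: "real measure" and \<tau> :: "real \<Rightarrow> real"
    and A :: "nat \<Rightarrow> nat \<Rightarrow> complex" and A_op :: l2_operator
  assumes "X \<in> sets borel"
    and "prob_space \<mu>" and "sets \<mu> = sets (restrict_space borel X)"
    and "\<tau> \<in> \<mu> \<rightarrow>\<^sub>M \<mu>"
    and "\<And>n. integrable \<mu> (\<lambda>x. x ^ n)"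
    and "\<And>n. integrable (distr \<mu> \<mu> \<tau>) (\<lambda>x. x ^ n)"
    and "\<And>n. (\<lambda>x. complex_of_real (\<tau> x) ^ n) \<in> poly_space \<mu>"
    and "\<And>k. k \<in> idx \<mu> \<Longrightarrow>
          L2_sums \<mu> (idx \<mu>) (\<lambda>j x. A j k * reduced_monomial \<mu> j x) (\<lambda>x. reduced_monomial \<mu> k (\<tau> x))"
    and "operator_in \<mu> (poly_space \<mu>) A_op"
    and "range monomial \<subseteq> op_dom A_op"
    and "\<And>j k. j \<in> idx \<mu> \<Longrightarrow> k \<in> idx \<mu> \<Longrightarrow>
          A j k = ip \<mu> (orth_poly \<mu> j) (op_app A_op (orth_poly \<mu> k))"
    and "densely_defined \<mu> (poly_space \<mu>) (op_comp (R_op \<mu>) A_op)"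
  shows "(\<exists>B. has_mat_prod (idx \<mu>) (moment_matrix \<mu> (reduced_monomial \<mu>)) A B \<and>
              has_mat_prod (idx \<mu>) (conj_transpose A) B
                (moment_matrix (distr \<mu> \<mu> \<tau>) (reduced_monomial \<mu>))) \<and>
         (\<exists>C. has_mat_prod (idx \<mu>) (conj_transpose A) (moment_matrix \<mu> (reduced_monomial \<mu>)) C \<and>
              has_mat_prod (idx \<mu>) C A
                (moment_matrix (distr \<mu> \<mu> \<tau>) (reduced_monomial \<mu>)))"
proof -
  define v where "v = reduced_monomial \<mu>"
  define w where "w k x = v k (\<tau> x)" for k x
  let ?I = "idx \<mu>"
  \<comment> \<open>The measurable sets of \<mu> are the Borel subsets of the subspace
    \<open>X\<close>, so the identity is measurable as a restriction.\<close>
  have id_meas: "(\<lambda>x. x) \<in> borel_measurable \<mu>"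
    using measurable_restrict_space1[OF measurable_ident, of borel X]
      measurable_cong_sets[OF assms(3) refl, of borel] by (auto simp: id_def)
  \<comment> \<open>No index condition is needed: whatever exponent \<open>enumerate\<close>
    returns, \<open>v k\<close> is a monomial.\<close>
  have v_L2: "v k \<in> L2 \<mu>" for k
    unfolding v_def reduced_monomial_def by (rule monomial_in_L2[OF id_meas assms(5)])
  have w_sums: "L2_sums \<mu> ?I (\<lambda>j x. A j k * v j x) (w k)" if "k \<in> ?I" for k
    using assms(8)[OF that] by (simp add: v_def w_def[abs_def])
  have w_L2: "w k \<in> L2 \<mu>" if "k \<in> ?I" for k
    using w_sums[OF that] by (simp add: L2_sums_def)
  \<comment> \<open>Scalars leave the integral without integrability, since a nonintegrable function
    has integral 0 by convention. The factor stands on the right to match the entries of a product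
    with right factor \<open>A\<close>.\<close>
  have ip_scale_right: "ip \<mu> h (\<lambda>x. c * f x) = ip \<mu> h f * c" for h f c
    unfolding ip_def mult.left_commute[of "cnj (h _)" c]
    by (simp only: integral_mult_right_zero mult.commute)
  have ip_scale_left: "ip \<mu> (\<lambda>x. c * f x) h = cnj c * ip \<mu> f h" for h f c
    unfolding ip_def by (simp add: mult.assoc)
  \<comment> \<open>The vector \<open>h\<close> stays free because it is later both some
    \<open>v j\<close> and some \<open>w j\<close>; in \<open>left\<close> it is \<open>w k\<close>
    or \<open>v k\<close>.\<close>
  have right: "(\<lambda>l. if l \<in> ?I then ip \<mu> h (v l) * A l k else 0) sums ip \<mu> h (w k)"
    if "h \<in> L2 \<mu>" "k \<in> ?I" for h k
    using L2_sums_ip_right[OF w_sums[OF that(2)] that(1)] by (simp only: ip_scale_right)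
  have left: "(\<lambda>l. if l \<in> ?I then cnj (A l j) * ip \<mu> (v l) h else 0) sums ip \<mu> (w j) h"
    if "h \<in> L2 \<mu>" "j \<in> ?I" for h j
    using L2_sums_ip_left[OF w_sums[OF that(2)] that(1)] by (simp only: ip_scale_left)
  have v_meas: "v k \<in> borel_measurable \<mu>" for k
    using v_L2[of k] by (simp add: L2_def)
  \<comment> \<open>Change of variables along \<tau>.\<close>
  have pushforward: "moment_matrix (distr \<mu> \<mu> \<tau>) v j k = ip \<mu> (w j) (w k)" for j k
    unfolding moment_matrix_def ip_def w_def using v_meas
    by (intro integral_distr[OF assms(4)] borel_measurable_times borel_measurable_cnj)
  \<comment> \<open>Associativity can fail for infinite matrices, so each bracketing gets its own
    explicit intermediate matrix, and all four series are shown to converge. They use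
    \<open>right\<close>, \<open>left\<close>, \<open>left\<close>, \<open>right\<close> in this
    order.\<close>
  have "has_mat_prod ?I (moment_matrix \<mu> v) A (\<lambda>j k. ip \<mu> (v j) (w k))"
    and "has_mat_prod ?I (conj_transpose A) (\<lambda>j k. ip \<mu> (v j) (w k)) (moment_matrix (distr \<mu> \<mu> \<tau>) v)"
    and "has_mat_prod ?I (conj_transpose A) (moment_matrix \<mu> v) (\<lambda>j k. ip \<mu> (w j) (v k))"
    and "has_mat_prod ?I (\<lambda>j k. ip \<mu> (w j) (v k)) A (moment_matrix (distr \<mu> \<mu> \<tau>) v)"
    unfolding has_mat_prod_def pushforward conj_transpose_def moment_matrix_def[of \<mu>]
    by (intro ballI right left v_L2 w_L2; assumption)+
  then show ?thesis
    unfolding v_def by blast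
qed

end
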